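(* Let $\tau':\Omega\to\mathbb R^+$ be a random time. Then $\tau'$ is a $\mathbb G$-stopping time if and only if there exists an $\widehat{\mathbb F}$-stopping time $\tau:\widehat\Omega\to\mathbb R^+$ such that $\tau'(\omega)=\tau(\omega,G(\omega))$ for $\mathbb P$-a.e. $\omega\in\Omega$.
   Context: Let $T>0$ and let $(\Omega,\mathcal F,\mathbb F=(\mathcal F_t)_{t\in[0,T]},\mathbb P)$ be a filtered probability space with $\mathbb F$ right-continuous and complete and $\mathcal F_0$ trivial. Let $G:\Omega\to\mathbb R$ be a random variable with law $P^G$, and let $\mathbb G=(\mathcal G_t)_{t\in[0,T]}$, $\mathcal G_t=\mathcal F_t\vee\sigma(G)$. Standing assumption (density hypothesis): for every $t\in[0,T]$ the regular conditional law of $G$ given $\mathcal F_t$ is equivalent to $P^G$ for $\mathbb P$-a.e. $\omega$ (it is known that then $\mathbb G$ is right-continuous). Product space: $\widehat\Omega=\Omega\times\mathbb R$, $\widehat{\mathcal F}=\mathcal F\otimes\mathcal B(\mathbb R)$, $\widehat{\mathcal F}_t=\bigcap_{s>t}(\mathcal F_s\otimes\mathcal B(\mathbb R))$, $\widehat{\mathbb F}=(\widehat{\mathcal F}_t)_{t\in[0,T]}$, $\widehat{\mathbb P}=\mathbb P\otimes P^G$. It is assumed (without loss of generality) that $(\widehat\Omega,\widehat{\mathcal F},\widehat{\mathbb P})$ is complete and that $\widehat{\mathcal F}_0$ contains all $\widehat{\mathbb P}$-null sets of $\widehat{\mathcal F}$. A random time $\tau$ is a stopping time of a filtration $(\mathcal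 H_t)_{t\in[0,T]}$ if $\{\tau\le t\}\in\mathcal H_t$ for all $t\in[0,T]$.
   Formalization: The product sigma-algebra is completed, and the product filtration is augmented only by subsets of null sets of F_T ⊗ B(R), not by all null sets of the product space; with all of them the "if" direction is false when G has a diffuse law. *)

theory Defs
  imports "HOL-Probability.Probability"
begin

text \<open>Filtrations indexed by $[0,T]$ are functions on \<^typ>\<open>real\<close> of which only the values
  on \<open>{0..T}\<close> are used; the member \<open>F t\<close> is a measure of which only the space and the
  \<open>\<sigma>\<close>-algebra are used.  (The library notions \<^locale>\<open>filtration\<close> and \<^const>\<open>stopping_time\<close>
  constrain all elements of the index type.)\<close>

definition filtration_upto :: "'a measure \<Rightarrow> real \<Rightarrow> (real \<Rightarrow> 'a measure) \<Rightarrow> bool" where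
  "filtration_upto M T F \<longleftrightarrow>
     (\<forall>t\<in>{0..T}. subalgebra M (F t)) \<and>
     (\<forall>s\<in>{0..T}. \<forall>t\<in>{0..T}. s \<le> t \<longrightarrow> sets (F s) \<subseteq> sets (F t))"

definition right_continuous_upto :: "real \<Rightarrow> (real \<Rightarrow> 'a measure) \<Rightarrow> bool" where
  "right_continuous_upto T F \<longleftrightarrow> (\<forall>t\<in>{0..<T}. sets (F t) = (\<Inter>s\<in>{t<..T}. sets (F s)))"

definition trivial_algebra :: "'a measure \<Rightarrow> 'a measure \<Rightarrow> bool" where
  "trivial_algebra M A \<longleftrightarrow> (\<forall>B\<in>sets A. measure M B = 0 \<or> measure M B = 1)"

definition random_time :: "'a measure \<Rightarrow> ('a \<Rightarrow> real) \<Rightarrow> bool" where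
  "random_time M \<tau> \<longleftrightarrow> \<tau> \<in> borel_measurable M \<and> (\<forall>\<omega>\<in>space M. 0 \<le> \<tau> \<omega>)"

text \<open>Stopping times may take values beyond \<open>T\<close>; nothing but measurability with respect
  to the ambient \<open>M\<close> is then required of those values.\<close>

definition stopping_time_upto ::
    "'a measure \<Rightarrow> real \<Rightarrow> (real \<Rightarrow> 'a measure) \<Rightarrow> ('a \<Rightarrow> real) \<Rightarrow> bool" where
  "stopping_time_upto M T H \<tau> \<longleftrightarrow>
     random_time M \<tau> \<and> (\<forall>t\<in>{0..T}. {\<omega>\<in>space M. \<tau> \<omega> \<le> t} \<in> sets (H t))"

definition regular_cond_law ::
    "'a measure \<Rightarrow> 'a measure \<Rightarrow> ('a \<Rightarrow> real) \<Rightarrow> ('a \<Rightarrow> real measure) \<Rightarrow> bool" where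
  "regular_cond_law M A G K \<longleftrightarrow>
     K \<in> A \<rightarrow>\<^sub>M prob_algebra borel \<and>
     (\<forall>B\<in>sets borel. AE \<omega> in M.
        measure (K \<omega>) B = real_cond_exp M A (indicat_real (G -` B \<inter> space M)) \<omega>)"

definition equivalent_measures :: "'b measure \<Rightarrow> 'b measure \<Rightarrow> bool" where
  "equivalent_measures M N \<longleftrightarrow> absolutely_continuous M N \<and> absolutely_continuous N M"

text \<open>A regular conditional law of a real random variable always exists and is unique up to a
  null set, so the existential quantifier could equally well be a universal one.\<close>

definition density_hypothesis ::
    "'a measure \<Rightarrow> real \<Rightarrow> (real \<Rightarrow> 'a measure) \<Rightarrow> ('a \<Rightarrow> real) \<Rightarrow> bool" where
  "density_hypothesis M T F G \<longleftrightarrow>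
     (\<forall>t\<in>{0..T}. \<exists>K. regular_cond_law M (F t) G K \<and>
        (AE \<omega> in M. equivalent_measures (K \<omega>) (distr M borel G)))"

definition initial_enlargement ::
    "'a measure \<Rightarrow> (real \<Rightarrow> 'a measure) \<Rightarrow> ('a \<Rightarrow> real) \<Rightarrow> real \<Rightarrow> 'a measure" where
  "initial_enlargement M F G t =
     sigma (space M) (sets (F t) \<union> {G -` B \<inter> space M | B. B \<in> sets borel})"

definition prod_prob :: "'a measure \<Rightarrow> ('a \<Rightarrow> real) \<Rightarrow> ('a \<times> real) measure" where
  "prod_prob M G = M \<Otimes>\<^sub>M distr M borel G"

text \<open>The null sets adjoined to the product filtration are all subsets of null sets of
  \<open>F T \<Otimes>\<^sub>M borel\<close>.  Null sets of \<open>M \<Otimes>\<^sub>M borel\<close> would be too many: under the density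
  hypothesis a \<open>G\<close> with diffuse law is not measurable with respect to \<open>F T\<close>, while its graph is a
  null set of \<open>M \<Otimes>\<^sub>M borel\<close> whose preimage under \<open>\<omega> \<mapsto> (\<omega>, G \<omega>)\<close> is the whole space.\<close>

definition prod_null_sets ::
    "'a measure \<Rightarrow> real \<Rightarrow> (real \<Rightarrow> 'a measure) \<Rightarrow> ('a \<Rightarrow> real) \<Rightarrow> ('a \<times> real) set set" where
  "prod_null_sets M T F G =
     null_sets (completion (restr_to_subalg (prod_prob M G) (F T \<Otimes>\<^sub>M borel)))"

text \<open>\<open>min s T\<close> extends the filtration constantly beyond \<open>T\<close>, which only matters for the
  intersection at \<open>t = T\<close>.  Augmentation commutes with the intersection over \<open>s > t\<close>, so the
  augmented filtration is again right-continuous.\<close>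

definition prod_filtration ::
    "'a measure \<Rightarrow> real \<Rightarrow> (real \<Rightarrow> 'a measure) \<Rightarrow> ('a \<Rightarrow> real) \<Rightarrow> real \<Rightarrow> ('a \<times> real) measure" where
  "prod_filtration M T F G t =
     sigma (space M \<times> UNIV)
       ((\<Inter>s\<in>{t<..}. sets (F (min s T) \<Otimes>\<^sub>M borel)) \<union> prod_null_sets M T F G)"

end

theory Submission
  imports Defs
begin

text \<open>Sets of the enlarged \<open>\<sigma>\<close>-algebra at time \<open>t\<close> are the preimages of sets of
  \<open>F t \<Otimes>\<^sub>M borel\<close> under the graph map \<open>\<omega> \<mapsto> (\<omega>, G \<omega>)\<close>.  Choosing such preimages \<open>A q\<close> of
  \<open>\<tau>' \<le> q\<close> for rational \<open>q\<close>, the infimum of all \<open>q\<close> with \<open>z \<in> A q\<close> is a stopping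
  time of the right-continuous product filtration that lifts \<open>\<tau>'\<close>.

  Conversely, a set of the product filtration at time \<open>t\<close> agrees up to a null set of the product
  measure with a set of \<open>F t \<Otimes>\<^sub>M borel\<close>, because its sections lie in \<open>F t\<close>.  The law of the graph
  map on \<open>F T \<Otimes>\<^sub>M borel\<close> integrates the conditional laws of \<open>G\<close>, so by the density hypothesis the
  graph almost surely avoids such null sets, and pulling back along the graph map gives a set of
  the enlarged filtration.\<close>

section \<open>Conditional expectations of sections of product sets\<close>

lemma subalgebra_pair_measure:
  assumes "subalgebra M A"
  shows "subalgebra (M \<Otimes>\<^sub>M N) (A \<Otimes>\<^sub>M N)"
proof -
  have "sets (A \<Otimes>\<^sub>M N) \<subseteq> sets (M \<Otimes>\<^sub>M N)"
    using assms unfolding sets_pair_measure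
    by (auto simp: subalgebra_def intro!: sigma_sets_mono')
  with assms show ?thesis
    by (auto simp: subalgebra_def space_pair_measure)
qed

context sigma_finite_subalgebra
begin

text \<open>Both series integrate term by term over every set of \<open>F\<close>, and these
  integrals determine the conditional expectation. It serves disjoint unions in the construction of
  a jointly measurable version.\<close>

lemma nn_cond_exp_suminf:
  assumes [measurable]: "\<And>i. f i \<in> borel_measurable M"
  shows "AE x in M. (\<Sum>i. nn_cond_exp M F (f i) x) = nn_cond_exp M F (\<lambda>x. \<Sum>i. f i x) x"
proof (rule nn_cond_exp_charact)
  fix A assume A[measurable]: "A \<in> sets F"
  then have [measurable]: "A \<in> sets M"
    using subalg by (auto simp: subalgebra_def)
  have [measurable]: "nn_cond_exp M F (f i) \<in> borel_measurable M" for i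
    by (rule measurable_from_subalg[OF subalg]) simp
  have "(\<integral>\<^sup>+x\<in>A. (\<Sum>i. f i x) \<partial>M) = (\<Sum>i. \<integral>\<^sup>+x. indicator A x * f i x \<partial>M)"
    by (subst nn_integral_suminf[symmetric]) (auto simp: mult.commute)
  also have "\<dots> = (\<Sum>i. \<integral>\<^sup>+x. indicator A x * nn_cond_exp M F (f i) x \<partial>M)"
    by (subst nn_cond_exp_intg) auto
  also have "\<dots> = (\<integral>\<^sup>+x\<in>A. (\<Sum>i. nn_cond_exp M F (f i) x) \<partial>M)"
    by (subst nn_integral_suminf[symmetric]) (auto simp: mult.commute)
  finally show "(\<integral>\<^sup>+x\<in>A. (\<Sum>i. f i x) \<partial>M) = (\<integral>\<^sup>+x\<in>A. (\<Sum>i. nn_cond_exp M F (f i) x) \<partial>M)" .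
qed auto

text \<open>One jointly measurable version of the conditional expectations of all sections makes
  Fubini's theorem applicable, although there are uncountably many exceptional null sets.\<close>

lemma nn_cond_exp_sections:
  assumes "C \<in> sets (M \<Otimes>\<^sub>M N)"
  shows "\<exists>g\<in>borel_measurable (F \<Otimes>\<^sub>M N). \<forall>x\<in>space N.
    AE \<omega> in M. nn_cond_exp M F (\<lambda>\<omega>. indicator C (\<omega>, x)) \<omega> = g (\<omega>, x)"
  using Int_stable_pair_measure_generator pair_measure_closed assms[unfolded sets_pair_measure]
proof (induction rule: sigma_sets_induct_disjoint)
  case (basic S)
  then obtain A B where S: "S = A \<times> B" and A[measurable]: "A \<in> sets M" and B[measurable]: "B \<in> sets N"
    by auto
  show ?case
  proof (intro bexI ballI)
    \<comment> \<open>On a rectangle the version factorises: for fixed \<open>x\<close> the factor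
      \<open>indicator B x\<close> is constant and leaves the conditional expectation.\<close>
    show "(\<lambda>z. nn_cond_exp M F (indicator A) (fst z) * indicator B (snd z)) \<in> borel_measurable (F \<Otimes>\<^sub>M N)"
      by measurable
    fix x assume "x \<in> space N"
    have "(\<lambda>\<omega>. indicator S (\<omega>, x)) = (\<lambda>\<omega>. (indicator B x :: ennreal) * indicator A \<omega>)"
      by (auto simp: S indicator_def)
    then show "AE \<omega> in M. nn_cond_exp M F (\<lambda>\<omega>. indicator S (\<omega>, x)) \<omega> =
        nn_cond_exp M F (indicator A) (fst (\<omega>, x)) * indicator B (snd (\<omega>, x))"
      using nn_cond_exp_prod[of "\<lambda>_. indicator B x" "indicator A"] by (auto simp: mult.commute)
  qed
next
  case empty
  show ?case
    using nn_cond_exp_F_meas[of "\<lambda>_. 0"] by (intro bexI[of _ "\<lambda>_. 0"] ballI) (auto elim: eventually_mono)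
next
  case (compl S)
  then obtain g where [measurable]: "g \<in> borel_measurable (F \<Otimes>\<^sub>M N)"
    and g: "\<And>x. x \<in> space N \<Longrightarrow> AE \<omega> in M. nn_cond_exp M F (\<lambda>\<omega>. indicator S (\<omega>, x)) \<omega> = g (\<omega>, x)"
    by blast
  have S[measurable]: "S \<in> sets (M \<Otimes>\<^sub>M N)"
    using compl.hyps by (simp add: sets_pair_measure)
  let ?C = "space M \<times> space N - S"
  show ?case
  proof (intro bexI ballI)
    show "(\<lambda>z. 1 - g z) \<in> borel_measurable (F \<Otimes>\<^sub>M N)"
      by measurable
    fix x assume x[measurable]: "x \<in> space N"
    have [measurable]: "?C \<in> sets (M \<Otimes>\<^sub>M N)"
      using S by (metis sets.compl_sets space_pair_measure)
    have [measurable]: "(\<lambda>\<omega>. indicator S (\<omega>, x) :: ennreal) \<in> borel_measurable M"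
        "(\<lambda>\<omega>. indicator ?C (\<omega>, x) :: ennreal) \<in> borel_measurable M"
      by measurable
    have "AE \<omega> in M. 1 = nn_cond_exp M F (\<lambda>\<omega>. 1) \<omega>"
      by (rule nn_cond_exp_F_meas) simp
    moreover have "AE \<omega> in M. nn_cond_exp M F (\<lambda>\<omega>. 1) \<omega> =
        nn_cond_exp M F (\<lambda>\<omega>. indicator S (\<omega>, x) + indicator ?C (\<omega>, x)) \<omega>"
      using x by (intro nn_cond_exp_cong) (auto simp: indicator_def)
    moreover have "AE \<omega> in M. nn_cond_exp M F (\<lambda>\<omega>. indicator S (\<omega>, x)) \<omega> +
        nn_cond_exp M F (\<lambda>\<omega>. indicator ?C (\<omega>, x)) \<omega> =
        nn_cond_exp M F (\<lambda>\<omega>. indicator S (\<omega>, x) + indicator ?C (\<omega>, x)) \<omega>"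
      by (intro nn_cond_exp_sum) auto
    ultimately show "AE \<omega> in M. nn_cond_exp M F (\<lambda>\<omega>. indicator ?C (\<omega>, x)) \<omega> = 1 - g (\<omega>, x)"
      using g[OF x]
    proof eventually_elim
      case (elim \<omega>)
      \<comment> \<open>Cancellation in \<open>ennreal\<close> needs a finite summand; a total of 1
        forces \<open>g (\<omega>, x)\<close> to be finite.\<close>
      then have sum: "g (\<omega>, x) + nn_cond_exp M F (\<lambda>\<omega>. indicator ?C (\<omega>, x)) \<omega> = 1"
        by simp
      moreover from this have "g (\<omega>, x) \<noteq> \<top>"
        by auto
      ultimately show ?case
        by (metis ennreal_add_diff_cancel_left)
    qed
  qed
next
  case (union S)
  then have "\<forall>i. \<exists>g\<in>borel_measurable (F \<Otimes>\<^sub>M N). \<forall>x\<in>space N.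
      AE \<omega> in M. nn_cond_exp M F (\<lambda>\<omega>. indicator (S i) (\<omega>, x)) \<omega> = g (\<omega>, x)"
    by blast
  then obtain g where [measurable]: "\<And>i. g i \<in> borel_measurable (F \<Otimes>\<^sub>M N)"
    and g: "\<And>i x. x \<in> space N \<Longrightarrow>
      AE \<omega> in M. nn_cond_exp M F (\<lambda>\<omega>. indicator (S i) (\<omega>, x)) \<omega> = g i (\<omega>, x)"
    by metis
  have [measurable]: "S i \<in> sets (M \<Otimes>\<^sub>M N)" for i
    using union.hyps by (auto simp: sets_pair_measure)
  show ?case
  proof (intro bexI ballI)
    show "(\<lambda>z. \<Sum>i. g i z) \<in> borel_measurable (F \<Otimes>\<^sub>M N)"
      by measurable
    fix x assume x[measurable]: "x \<in> space N"
    have "(\<lambda>\<omega>. \<Sum>i. indicator (S i) (\<omega>, x) :: ennreal) = (\<lambda>\<omega>. indicator (\<Union>i. S i) (\<omega>, x))"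
      using suminf_indicator[OF union.hyps(1)] by auto
    then have "AE \<omega> in M. (\<Sum>i. nn_cond_exp M F (\<lambda>\<omega>. indicator (S i) (\<omega>, x)) \<omega>) =
        nn_cond_exp M F (\<lambda>\<omega>. indicator (\<Union>i. S i) (\<omega>, x)) \<omega>"
      using nn_cond_exp_suminf[of "\<lambda>i \<omega>. indicator (S i) (\<omega>, x)"] by simp
    moreover have "AE \<omega> in M. \<forall>i. nn_cond_exp M F (\<lambda>\<omega>. indicator (S i) (\<omega>, x)) \<omega> = g i (\<omega>, x)"
      using g[OF x] by (simp add: AE_all_countable)
    ultimately show "AE \<omega> in M. nn_cond_exp M F (\<lambda>\<omega>. indicator (\<Union>i. S i) (\<omega>, x)) \<omega> =
        (\<Sum>i. g i (\<omega>, x))"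
      by eventually_elim auto
  qed
qed

text \<open>Conditioning leaves an \<open>F\<close>-measurable section unchanged, so the jointly
  measurable version \<open>g\<close> agrees with the indicator of \<open>C\<close> almost
  everywhere on each section, and by Fubini almost everywhere on the product. Up to null sets, this
  moves the intersection over later times past the product with \<open>borel\<close>.\<close>

lemma sections_in_subalgebra_imp_AE_eq:
  assumes "sigma_finite_measure M" "sigma_finite_measure N"
    and C[measurable]: "C \<in> sets (M \<Otimes>\<^sub>M N)"
    and sections: "\<And>x. x \<in> space N \<Longrightarrow> (\<lambda>\<omega>. (\<omega>, x)) -` C \<inter> space M \<in> sets F"
  shows "\<exists>C'\<in>sets (F \<Otimes>\<^sub>M N). AE z in M \<Otimes>\<^sub>M N. z \<in> C \<longleftrightarrow> z \<in> C'"
proof -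
  interpret pair_sigma_finite M N
    using assms by (simp add: pair_sigma_finite_def)
  obtain g where g_meas[measurable]: "g \<in> borel_measurable (F \<Otimes>\<^sub>M N)"
    and g: "\<And>x. x \<in> space N \<Longrightarrow> AE \<omega> in M. nn_cond_exp M F (\<lambda>\<omega>. indicator C (\<omega>, x)) \<omega> = g (\<omega>, x)"
    using nn_cond_exp_sections[OF C] by blast
  have [measurable]: "g \<in> borel_measurable (M \<Otimes>\<^sub>M N)"
    by (rule measurable_from_subalg[OF subalgebra_pair_measure[OF subalg] g_meas])
  have "AE \<omega> in M. indicator C (\<omega>, x) = g (\<omega>, x)" if x: "x \<in> space N" for x
  proof -
    have "(\<lambda>\<omega>. indicator C (\<omega>, x) :: ennreal) \<in> borel_measurable F \<longleftrightarrow>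
        (indicator ((\<lambda>\<omega>. (\<omega>, x)) -` C \<inter> space M) :: _ \<Rightarrow> ennreal) \<in> borel_measurable F"
      using subalg by (intro measurable_cong) (auto simp: indicator_def subalgebra_def)
    then have "(\<lambda>\<omega>. indicator C (\<omega>, x) :: ennreal) \<in> borel_measurable F"
      using sections[OF x] by simp
    from nn_cond_exp_F_meas[OF this] g[OF x] show ?thesis
      by eventually_elim simp
  qed
  then have "AE x in N. AE \<omega> in M. indicator C (\<omega>, x) = g (\<omega>, x)"
    by (rule AE_I2)
  \<comment> \<open>Each \<open>x\<close> has its own exceptional null set; joint measurability of
    both sides allows the quantifiers to be swapped.\<close>
  then have "AE \<omega> in M. AE x in N. indicator C (\<omega>, x) = g (\<omega>, x)"
    by (subst AE_commute) auto
  then have eq: "AE z in M \<Otimes>\<^sub>M N. indicator C z = g z"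
    by (intro AE_pair_measure) auto
  show ?thesis
  proof (intro bexI)
    show "g -` {1} \<inter> space (F \<Otimes>\<^sub>M N) \<in> sets (F \<Otimes>\<^sub>M N)"
      by measurable
    show "AE z in M \<Otimes>\<^sub>M N. z \<in> C \<longleftrightarrow> z \<in> g -` {1} \<inter> space (F \<Otimes>\<^sub>M N)"
      using eq AE_space
    proof eventually_elim
      case (elim z)
      then show ?case
        using subalg by (auto simp: subalgebra_def space_pair_measure indicator_def split: if_splits)
    qed
  qed
qed

end

section \<open>The law of the graph map and null sets of the product measure\<close>

text \<open>This disintegrates the law of \<open>(\<omega>, G \<omega>)\<close> along
  \<open>A\<close>. On a rectangle \<open>D \<times> B\<close> it is the defining property of the
  conditional probability that \<open>G\<close> lies in \<open>B\<close>, tested on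
  \<open>D\<close>; a Dynkin argument extends it to the product \<sigma>-algebra.\<close>

lemma emeasure_graph_regular_cond_law:
  assumes "prob_space M" and sub: "subalgebra M A" and G[measurable]: "G \<in> borel_measurable M"
    and K: "regular_cond_law M A G K" and C: "C \<in> sets (A \<Otimes>\<^sub>M borel)"
  shows "emeasure M ((\<lambda>\<omega>. (\<omega>, G \<omega>)) -` C \<inter> space M) = (\<integral>\<^sup>+\<omega>. emeasure (K \<omega>) (Pair \<omega> -` C) \<partial>M)"
proof -
  interpret prob_space M by fact
  interpret finite_measure_subalgebra M A
    by unfold_locales fact
  have [measurable]: "(\<lambda>\<omega>. \<omega>) \<in> M \<rightarrow>\<^sub>M A"
    by (rule measurable_from_subalg[OF sub measurable_ident_sets[OF refl]])
  have \<phi>[measurable]: "(\<lambda>\<omega>. (\<omega>, G \<omega>)) \<in> M \<rightarrow>\<^sub>M A \<Otimes>\<^sub>M borel"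
    by measurable
  have space_A: "space A = space M"
    using sub by (simp add: subalgebra_def)
  have KA: "K \<in> A \<rightarrow>\<^sub>M prob_algebra borel"
    using K by (simp add: regular_cond_law_def)
  have K_space: "prob_space (K \<omega>)" "sets (K \<omega>) = sets borel" if "\<omega> \<in> space M" for \<omega>
    using measurable_space[OF KA, of \<omega>] that by (auto simp: space_prob_algebra space_A)
  have K_meas: "(\<lambda>\<omega>. emeasure (K \<omega>) (Pair \<omega> -` S)) \<in> borel_measurable M"
    if "S \<in> sets (A \<Otimes>\<^sub>M borel)" for S
  proof (rule measurable_from_subalg[OF sub])
    have "(SIGMA \<omega>:space A. Pair \<omega> -` S) = S"
      using sets.sets_into_space[OF that] by (auto simp: space_pair_measure)
    then show "(\<lambda>\<omega>. emeasure (K \<omega>) (Pair \<omega> -` S)) \<in> borel_measurable A"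
      using that by (intro emeasure_measurable_subprob_algebra2[OF _ measurable_prob_algebraD[OF KA]]) simp
  qed
  show ?thesis
    using Int_stable_pair_measure_generator pair_measure_closed C[unfolded sets_pair_measure]
  proof (induction rule: sigma_sets_induct_disjoint)
    case (basic S)
    then obtain D B where S: "S = D \<times> B" and D[measurable]: "D \<in> sets A" and B[measurable]: "B \<in> sets borel"
      by auto
    have DM[measurable]: "D \<in> sets M"
      using D sub by (auto simp: subalgebra_def)
    let ?h = "indicat_real (G -` B \<inter> space M)"
    have ae: "AE \<omega> in M. measure (K \<omega>) B = real_cond_exp M A ?h \<omega>"
      using K B by (auto simp: regular_cond_law_def)
    have int: "integrable M (\<lambda>\<omega>. indicator D \<omega> * ?h \<omega>)"
      by (rule integrable_const_bound[where B = 1]) (auto simp: indicator_def)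
    have [measurable]: "(\<lambda>\<omega>. measure (K \<omega>) B) \<in> borel_measurable M"
      by (rule measurable_from_subalg[OF sub measurable_compose[OF KA measurable_measure_prob_algebra[OF B]]])
    have "(\<integral>\<^sup>+\<omega>. emeasure (K \<omega>) (Pair \<omega> -` S) \<partial>M) = (\<integral>\<^sup>+\<omega>. ennreal (indicator D \<omega> * measure (K \<omega>) B) \<partial>M)"
    proof (rule nn_integral_cong)
      fix \<omega> assume "\<omega> \<in> space M"
      then interpret K: prob_space "K \<omega>" by (rule K_space)
      show "emeasure (K \<omega>) (Pair \<omega> -` S) = ennreal (indicator D \<omega> * measure (K \<omega>) B)"
        by (auto simp: S K.emeasure_eq_measure indicator_def)
    qed
    also have "\<dots> = ennreal (\<integral>\<omega>. indicator D \<omega> * measure (K \<omega>) B \<partial>M)"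
    proof (rule nn_integral_eq_integral)
      show "integrable M (\<lambda>\<omega>. indicator D \<omega> * measure (K \<omega>) B)"
        by (rule integrable_const_bound[where B = 1])
          (auto simp: indicator_def K_space prob_space.prob_le_1 intro!: AE_I2)
    qed auto
    also have "(\<integral>\<omega>. indicator D \<omega> * measure (K \<omega>) B \<partial>M) = (\<integral>\<omega>. indicator D \<omega> * real_cond_exp M A ?h \<omega> \<partial>M)"
      using ae by (intro integral_cong_AE) auto
    \<comment> \<open>Since \<open>D\<close> belongs to \<open>A\<close>, the conditioning can be
      undone under the integral over \<open>D\<close>.\<close>
    also have "\<dots> = (\<integral>\<omega>. indicator D \<omega> * ?h \<omega> \<partial>M)"
      by (rule real_cond_exp_intg(2)[OF int]) auto
    also have "\<dots> = (\<integral>\<omega>. indicator ((\<lambda>\<omega>. (\<omega>, G \<omega>)) -` S \<inter> space M) \<omega> \<partial>M)"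
      by (intro Bochner_Integration.integral_cong) (auto simp: S indicator_def)
    also have "\<dots> = measure M ((\<lambda>\<omega>. (\<omega>, G \<omega>)) -` S \<inter> space M)"
      by simp
    finally show ?case
      by (simp add: emeasure_eq_measure)
  next
    case empty
    then show ?case by simp
  next
    case (compl S)
    then have S: "S \<in> sets (A \<Otimes>\<^sub>M borel)"
      by (simp add: sets_pair_measure)
    have "(\<lambda>\<omega>. (\<omega>, G \<omega>)) -` (space A \<times> space borel - S) \<inter> space M =
        space M - ((\<lambda>\<omega>. (\<omega>, G \<omega>)) -` S \<inter> space M)"
      by (auto simp: space_A)
    then have "emeasure M ((\<lambda>\<omega>. (\<omega>, G \<omega>)) -` (space A \<times> space borel - S) \<inter> space M) =
        1 - (\<integral>\<^sup>+\<omega>. emeasure (K \<omega>) (Pair \<omega> -` S) \<partial>M)"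
      by (metis emeasure_compl[OF measurable_sets[OF \<phi> S]] compl.IH emeasure_space_1 emeasure_finite infinity_ennreal_def)
    also have "\<dots> = (\<integral>\<^sup>+\<omega>. 1 - emeasure (K \<omega>) (Pair \<omega> -` S) \<partial>M)"
    proof (subst nn_integral_diff)
      show "(\<integral>\<^sup>+\<omega>. emeasure (K \<omega>) (Pair \<omega> -` S) \<partial>M) \<noteq> \<infinity>"
        using compl.IH by (metis emeasure_finite infinity_ennreal_def)
      show "AE \<omega> in M. emeasure (K \<omega>) (Pair \<omega> -` S) \<le> 1"
        using K_space by (auto intro!: AE_I2 prob_space.emeasure_le_1)
    qed (use S in \<open>auto simp: K_meas emeasure_space_1\<close>)
    also have "\<dots> = (\<integral>\<^sup>+\<omega>. emeasure (K \<omega>) (Pair \<omega> -` (space A \<times> space borel - S)) \<partial>M)"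
    proof (rule nn_integral_cong)
      fix \<omega> assume \<omega>: "\<omega> \<in> space M"
      then interpret K: prob_space "K \<omega>" by (rule K_space)
      have "Pair \<omega> -` (space A \<times> space borel - S) = space (K \<omega>) - Pair \<omega> -` S"
        using \<omega> sets_eq_imp_space_eq[OF K_space(2)[OF \<omega>]] by (auto simp: space_A)
      moreover have "Pair \<omega> -` S \<in> sets (K \<omega>)"
        using sets_Pair1[OF S] K_space(2)[OF \<omega>] by simp
      ultimately show "1 - emeasure (K \<omega>) (Pair \<omega> -` S) =
          emeasure (K \<omega>) (Pair \<omega> -` (space A \<times> space borel - S))"
        by (simp add: emeasure_compl K.emeasure_space_1)
    qed
    finally show ?case .
  next
    case (union S)
    have S: "S i \<in> sets (A \<Otimes>\<^sub>M borel)" for i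
      using union.hyps by (auto simp: sets_pair_measure)
    have "emeasure M ((\<lambda>\<omega>. (\<omega>, G \<omega>)) -` (\<Union>i. S i) \<inter> space M) =
        emeasure M (\<Union>i. (\<lambda>\<omega>. (\<omega>, G \<omega>)) -` S i \<inter> space M)"
      by (rule arg_cong[where f = "emeasure M"]) auto
    also have "\<dots> = (\<Sum>i. emeasure M ((\<lambda>\<omega>. (\<omega>, G \<omega>)) -` S i \<inter> space M))"
      using S union.hyps(1) by (intro suminf_emeasure[symmetric])
        (auto simp: disjoint_family_on_def intro!: measurable_sets[OF \<phi>])
    also have "\<dots> = (\<integral>\<^sup>+\<omega>. (\<Sum>i. emeasure (K \<omega>) (Pair \<omega> -` S i)) \<partial>M)"
      using S by (simp add: union.IH nn_integral_suminf K_meas)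
    also have "\<dots> = (\<integral>\<^sup>+\<omega>. emeasure (K \<omega>) (Pair \<omega> -` (\<Union>i. S i)) \<partial>M)"
    proof (rule nn_integral_cong)
      fix \<omega> assume \<omega>: "\<omega> \<in> space M"
      have "Pair \<omega> -` S i \<in> sets (K \<omega>)" for i
        using sets_Pair1[OF S] K_space(2)[OF \<omega>] by simp
      then show "(\<Sum>i. emeasure (K \<omega>) (Pair \<omega> -` S i)) = emeasure (K \<omega>) (Pair \<omega> -` (\<Union>i. S i))"
        using union.hyps(1) by (subst suminf_emeasure) (auto simp: disjoint_family_on_def vimage_UN)
    qed
    finally show ?case .
  qed
qed

text \<open>By Fubini almost every section of \<open>C\<close> is null for the law of
  \<open>G\<close>, hence null for \<open>K \<omega>\<close>, and the disintegration gives its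
  preimage under the graph map mass zero. Membership of \<open>C\<close> in
  \<open>A \<Otimes>\<^sub>M borel\<close> matters: the graph of \<open>G\<close> itself can be a
  null set of \<open>prod_prob M G\<close>.\<close>

lemma graph_avoids_prod_null_set:
  assumes "prob_space M" "subalgebra M A" "G \<in> borel_measurable M" "regular_cond_law M A G K"
    and equiv: "AE \<omega> in M. equivalent_measures (K \<omega>) (distr M borel G)"
    and C: "C \<in> sets (A \<Otimes>\<^sub>M borel)" "C \<in> null_sets (prod_prob M G)"
  shows "AE \<omega> in M. (\<omega>, G \<omega>) \<notin> C"
proof -
  interpret M: prob_space M by fact
  interpret P: prob_space "distr M borel G"
    by (rule M.prob_space_distr) fact
  interpret pair_sigma_finite M "distr M borel G" ..
  have [measurable]: "(\<lambda>\<omega>. \<omega>) \<in> M \<rightarrow>\<^sub>M A"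
    by (rule measurable_from_subalg[OF assms(2) measurable_ident_sets[OF refl]])
  have \<phi>: "(\<lambda>\<omega>. (\<omega>, G \<omega>)) \<in> M \<rightarrow>\<^sub>M A \<Otimes>\<^sub>M borel"
    using assms(3) by measurable
  have "AE z in M \<Otimes>\<^sub>M distr M borel G. z \<notin> C"
    using C(2) by (auto simp: prod_prob_def intro: AE_not_in)
  then have "AE \<omega> in M. AE x in distr M borel G. (\<omega>, x) \<notin> C"
    by (rule AE_pair)
  with equiv have "AE \<omega> in M. emeasure (K \<omega>) (Pair \<omega> -` C) = 0"
  proof eventually_elim
    case (elim \<omega>)
    have "Pair \<omega> -` C \<in> sets (distr M borel G)"
      using sets_Pair1[OF C(1)] by simp
    then have "Pair \<omega> -` C \<in> null_sets (distr M borel G)"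
      using elim(2) by (subst AE_iff_null_sets) auto
    then show ?case
      using elim(1) by (auto simp: equivalent_measures_def absolutely_continuous_def)
  qed
  then have "(\<integral>\<^sup>+\<omega>. emeasure (K \<omega>) (Pair \<omega> -` C) \<partial>M) = (\<integral>\<^sup>+\<omega>. 0 \<partial>M)"
    by (rule nn_integral_cong_AE)
  then have "emeasure M ((\<lambda>\<omega>. (\<omega>, G \<omega>)) -` C \<inter> space M) = 0"
    using emeasure_graph_regular_cond_law[OF assms(1-4) C(1)] by simp
  then have "(\<lambda>\<omega>. (\<omega>, G \<omega>)) -` C \<inter> space M \<in> null_sets M"
    using measurable_sets[OF \<phi> C(1)] by auto
  from AE_not_in[OF this] AE_space show ?thesis
    by eventually_elim auto
qed

section \<open>The enlarged filtration as a pullback along the graph map\<close>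

lemma space_initial_enlargement [simp]: "space (initial_enlargement M F G t) = space M"
  by (simp add: initial_enlargement_def space_measure_of_conv)

context
  fixes M :: "'a measure" and F :: "real \<Rightarrow> 'a measure" and G :: "'a \<Rightarrow> real" and t :: real
  assumes sub: "subalgebra M (F t)"
begin

lemma sets_initial_enlargement:
  "sets (initial_enlargement M F G t) =
    sigma_sets (space M) (sets (F t) \<union> {G -` B \<inter> space M | B. B \<in> sets borel})"
  unfolding initial_enlargement_def using sub sets.sets_into_space[of _ "F t"]
  by (intro sets_measure_of) (auto simp: subalgebra_def)

lemma sets_subset_initial_enlargement: "sets (F t) \<subseteq> sets (initial_enlargement M F G t)"
  by (auto simp: sets_initial_enlargement)

lemma graph_measurable_initial_enlargement:
  "(\<lambda>\<omega>. (\<omega>, G \<omega>)) \<in> initial_enlargement M F G t \<rightarrow>\<^sub>M F t \<Otimes>\<^sub>M borel"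
proof (rule measurable_Pair)
  show "(\<lambda>\<omega>. \<omega>) \<in> initial_enlargement M F G t \<rightarrow>\<^sub>M F t"
    using sub sets_subset_initial_enlargement
    by (intro measurable_from_subalg[OF _ measurable_ident_sets[OF refl]]) (auto simp: subalgebra_def)
  show "G \<in> initial_enlargement M F G t \<rightarrow>\<^sub>M borel"
    by (rule measurableI) (auto simp: sets_initial_enlargement)
qed

text \<open>Preimages under the graph map form a \<sigma>-algebra, which contains both kinds of
  generators as preimages of \<open>D \<times> UNIV\<close> and
  \<open>space M \<times> B\<close>.\<close>

lemma initial_enlargement_set_eq_graph_vimage:
  assumes "S \<in> sets (initial_enlargement M F G t)"
  shows "\<exists>A\<in>sets (F t \<Otimes>\<^sub>M borel). S = (\<lambda>\<omega>. (\<omega>, G \<omega>)) -` A \<inter> space M"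
proof -
  let ?V = "vimage_algebra (space M) (\<lambda>\<omega>. (\<omega>, G \<omega>)) (F t \<Otimes>\<^sub>M borel)"
  have space: "space (F t) = space M"
    using sub by (simp add: subalgebra_def)
  then have V: "sets ?V = {(\<lambda>\<omega>. (\<omega>, G \<omega>)) -` A \<inter> space M | A. A \<in> sets (F t \<Otimes>\<^sub>M borel)}"
    by (intro sets_vimage_algebra2) (auto simp: space_pair_measure)
  have "D \<in> sets ?V" if "D \<in> sets (F t)" for D
    unfolding V using that sets.sets_into_space[OF that] space
    by (intro CollectI exI[of _ "D \<times> UNIV"]) auto
  moreover have "G -` B \<inter> space M \<in> sets ?V" if "B \<in> sets borel" for B
    unfolding V using that sets.top[of "F t"] space
    by (intro CollectI exI[of _ "space M \<times> B"]) auto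
  ultimately have "sets (F t) \<union> {G -` B \<inter> space M | B. B \<in> sets borel} \<subseteq> sets ?V"
    by blast
  from sets.sigma_sets_subset[OF this] have "sets (initial_enlargement M F G t) \<subseteq> sets ?V"
    unfolding sets_initial_enlargement space_vimage_algebra .
  with assms have "S \<in> sets ?V" ..
  then show ?thesis
    unfolding V by blast
qed

end

section \<open>Pulling back the product filtration\<close>

lemma space_prod_prob [simp]: "space (prod_prob M G) = space M \<times> UNIV"
  by (simp add: prod_prob_def space_pair_measure)

context
  fixes M :: "'a measure" and T :: real and F :: "real \<Rightarrow> 'a measure" and G :: "'a \<Rightarrow> real"
  assumes T: "0 < T"
    and prob: "prob_space M"
    and complete: "complete_measure M"
    and filtration: "filtration_upto M T F"
    and right_continuous: "right_continuous_upto T F"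
    and null_sets_F0: "null_sets M \<subseteq> sets (F 0)"
    and G: "G \<in> borel_measurable M"
    and density: "density_hypothesis M T F G"
begin

interpretation prob_space M by (rule prob)
interpretation complete_measure M by (rule complete)

lemma subalgebra_filtration: "t \<in> {0..T} \<Longrightarrow> subalgebra M (F t)"
  using filtration by (auto simp: filtration_upto_def)

lemma sets_filtration_mono: "s \<in> {0..T} \<Longrightarrow> t \<in> {0..T} \<Longrightarrow> s \<le> t \<Longrightarrow> sets (F s) \<subseteq> sets (F t)"
  using filtration by (auto simp: filtration_upto_def)

lemma subalgebra_filtration_mono:
  "s \<in> {0..T} \<Longrightarrow> t \<in> {0..T} \<Longrightarrow> s \<le> t \<Longrightarrow> subalgebra (F t) (F s)"
  using sets_filtration_mono[of s t] subalgebra_filtration[of s] subalgebra_filtration[of t]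
  by (simp add: subalgebra_def)

lemma sets_filtration_pair_mono:
  "s \<in> {0..T} \<Longrightarrow> t \<in> {0..T} \<Longrightarrow> s \<le> t \<Longrightarrow> sets (F s \<Otimes>\<^sub>M N) \<subseteq> sets (F t \<Otimes>\<^sub>M N)"
  using subalgebra_pair_measure[OF subalgebra_filtration_mono, of s t N]
  by (simp add: subalgebra_def)

lemma null_sets_subset_filtration: "t \<in> {0..T} \<Longrightarrow> null_sets M \<subseteq> sets (F t)"
  using null_sets_F0 sets_filtration_mono[of 0 t] by auto

text \<open>Right-continuity covers \<open>t < T\<close>. At \<open>t = T\<close> every index
  \<open>min s T\<close> is \<open>T\<close> itself, so a single \<open>s > T\<close>
  suffices.\<close>

lemma filtration_Inter:
  assumes t: "t \<in> {0..T}" and D: "\<And>s. t < s \<Longrightarrow> D \<in> sets (F (min s T))"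
  shows "D \<in> sets (F t)"
proof (cases "t = T")
  case True
  then show ?thesis using D[of "T + 1"] by simp
next
  case False
  have "D \<in> sets (F s)" if "s \<in> {t<..T}" for s
    using D[of s] that by simp
  with False t right_continuous show ?thesis
    by (auto simp: right_continuous_upto_def)
qed

lemma subalgebra_prod_prob: "t \<in> {0..T} \<Longrightarrow> subalgebra (prod_prob M G) (F t \<Otimes>\<^sub>M borel)"
  using subalgebra_pair_measure[OF subalgebra_filtration, of t "distr M borel G"]
    sets_pair_measure_cong[of "F t" "F t" "distr M borel G" borel]
  by (simp add: subalgebra_def prod_prob_def space_pair_measure)

lemma prod_filtration_generators_subset:
  "(\<Inter>s\<in>{t<..}. sets (F (min s T) \<Otimes>\<^sub>M borel)) \<union> prod_null_sets M T F G \<subseteq> Pow (space M \<times> UNIV)"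
proof -
  have "prod_null_sets M T F G \<subseteq> Pow (space M \<times> UNIV)"
    using sets.sets_into_space by (fastforce simp: prod_null_sets_def space_restr_to_subalg)
  moreover have "A \<in> Pow (space M \<times> UNIV)" if "A \<in> (\<Inter>s\<in>{t<..}. sets (F (min s T) \<Otimes>\<^sub>M borel))" for A
  proof -
    \<comment> \<open>An index above \<open>t\<close> and at least \<open>T\<close>: it takes part
      in the intersection, and \<open>min\<close> turns it into \<open>T\<close> whatever
      \<open>t\<close> is.\<close>
    have "A \<in> sets (F (min (max (t + 1) T) T) \<Otimes>\<^sub>M borel)"
      using that by (rule INT_D) auto
    then have "A \<in> sets (F T \<Otimes>\<^sub>M borel)"
      by simp
    then show ?thesis
      using sets.sets_into_space subalgebra_filtration[of T] T
      by (fastforce simp: space_pair_measure subalgebra_def)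
  qed
  ultimately show ?thesis by blast
qed

text \<open>The conditional law at the terminal time is the right one to use, because
  \<open>F T \<Otimes>\<^sub>M borel\<close> contains the product \<sigma>-algebras of all earlier
  times.\<close>

lemma graph_avoids_null_set:
  assumes "C \<in> sets (F T \<Otimes>\<^sub>M borel)" "C \<in> null_sets (prod_prob M G)"
  shows "AE \<omega> in M. (\<omega>, G \<omega>) \<notin> C"
proof -
  obtain K where "regular_cond_law M (F T) G K"
      "AE \<omega> in M. equivalent_measures (K \<omega>) (distr M borel G)"
    using density T by (fastforce simp: density_hypothesis_def)
  then show ?thesis
    using graph_avoids_prod_null_set[OF prob subalgebra_filtration G _ _ assms] T by simp
qed

text \<open>An adjoined null set is covered by a null set in
  \<open>F T \<Otimes>\<^sub>M borel\<close>, which the graph almost surely avoids. Completeness of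
  \<open>M\<close> then makes the preimage measurable.\<close>

lemma graph_vimage_prod_null_sets:
  assumes N: "N \<in> prod_null_sets M T F G"
  shows "(\<lambda>\<omega>. (\<omega>, G \<omega>)) -` N \<inter> space M \<in> null_sets M"
proof -
  have "subalgebra (prod_prob M G) (F T \<Otimes>\<^sub>M borel)"
    using T by (intro subalgebra_prod_prob) simp
  from N obtain C where C: "C \<in> sets (F T \<Otimes>\<^sub>M borel)" "C \<in> null_sets (prod_prob M G)" "N \<subseteq> C"
    unfolding prod_null_sets_def null_sets_completion_iff2
      null_sets_restr_to_subalg[OF \<open>subalgebra (prod_prob M G) (F T \<Otimes>\<^sub>M borel)\<close>] by auto
  have "AE \<omega> in M. \<omega> \<notin> (\<lambda>\<omega>. (\<omega>, G \<omega>)) -` N \<inter> space M"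
    using graph_avoids_null_set[OF C(1,2)] by eventually_elim (use C(3) in auto)
  then show ?thesis
    by (simp add: null_sets_iff_AE)
qed

text \<open>By right-continuity of \<open>F\<close>, each section of a set in the intersection is already
  \<open>F t\<close>-measurable; right-continuity of the enlarged filtration is therefore not needed.\<close>

lemma graph_vimage_Inter:
  assumes t: "t \<in> {0..T}" and A: "A \<in> (\<Inter>s\<in>{t<..}. sets (F (min s T) \<Otimes>\<^sub>M borel))"
  shows "(\<lambda>\<omega>. (\<omega>, G \<omega>)) -` A \<inter> space M \<in> sets (initial_enlargement M F G t)"
proof -
  let ?P = "distr M borel G"
  interpret Ft: finite_measure_subalgebra M "F t"
    by unfold_locales (rule subalgebra_filtration[OF t])
  interpret P: prob_space ?P
    by (rule prob_space_distr) (rule G)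
  have A': "A \<in> sets (F (min s T) \<Otimes>\<^sub>M borel)" if "t < s" for s
    using A that by auto
  then have A_T: "A \<in> sets (F T \<Otimes>\<^sub>M borel)"
    using A'[of "T + 1"] t by simp
  then have A_M: "A \<in> sets (M \<Otimes>\<^sub>M ?P)"
    using subalgebra_prod_prob[of T] T by (auto simp: subalgebra_def prod_prob_def)
  have sections: "(\<lambda>\<omega>. (\<omega>, x)) -` A \<inter> space M \<in> sets (F t)" for x
  proof (rule filtration_Inter[OF t])
    fix s assume s: "t < s"
    have "min s T \<in> {0..T}"
      using s t T by auto
    then have "A \<subseteq> space M \<times> UNIV"
      using sets.sets_into_space[OF A'[OF s]] subalgebra_filtration[of "min s T"]
      by (simp add: space_pair_measure subalgebra_def)
    then have "(\<lambda>\<omega>. (\<omega>, x)) -` A \<inter> space M = (\<lambda>\<omega>. (\<omega>, x)) -` A"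
      by auto
    then show "(\<lambda>\<omega>. (\<omega>, x)) -` A \<inter> space M \<in> sets (F (min s T))"
      using sets_Pair2[OF A'[OF s]] by simp
  qed
  obtain C where C: "C \<in> sets (F t \<Otimes>\<^sub>M ?P)" and eq: "AE z in M \<Otimes>\<^sub>M ?P. z \<in> A \<longleftrightarrow> z \<in> C"
    using Ft.sections_in_subalgebra_imp_AE_eq[OF sigma_finite_measure_axioms
        P.sigma_finite_measure_axioms A_M sections]
    by auto
  have "sets (F t \<Otimes>\<^sub>M ?P) = sets (F t \<Otimes>\<^sub>M borel)"
    by (intro sets_pair_measure_cong) auto
  with C have C: "C \<in> sets (F t \<Otimes>\<^sub>M borel)"
    by simp
  then have C_T: "C \<in> sets (F T \<Otimes>\<^sub>M borel)"
    using sets_filtration_pair_mono[of t T] t T by auto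
  \<comment> \<open>\<open>A\<close> and \<open>C\<close> both lie in
    \<open>F T \<Otimes>\<^sub>M borel\<close>, so the graph almost surely avoids their symmetric
    difference.\<close>
  let ?D = "(A - C) \<union> (C - A)"
  have D: "?D \<in> sets (F T \<Otimes>\<^sub>M borel)"
    using A_T C_T by auto
  then have "?D \<in> sets (prod_prob M G)"
    using subalgebra_prod_prob[of T] T by (auto simp: subalgebra_def)
  moreover have "AE z in prod_prob M G. z \<notin> ?D"
    using eq unfolding prod_prob_def by eventually_elim auto
  ultimately have "?D \<in> null_sets (prod_prob M G)"
    using Measure_Space.AE_iff_null_sets by blast
  with D have "AE \<omega> in M. (\<omega>, G \<omega>) \<notin> ?D"
    by (rule graph_avoids_null_set)
  let ?E = "initial_enlargement M F G t"
  let ?\<phi> = "\<lambda>\<omega>. (\<omega>, G \<omega>)"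
  have null: "?\<phi> -` S \<inter> space M \<in> sets ?E" if "S \<subseteq> ?D" for S
  proof -
    have "AE \<omega> in M. \<omega> \<notin> ?\<phi> -` S \<inter> space M"
      using \<open>AE \<omega> in M. (\<omega>, G \<omega>) \<notin> ?D\<close> by eventually_elim (use that in auto)
    then have "?\<phi> -` S \<inter> space M \<in> null_sets M"
      by (simp add: null_sets_iff_AE)
    then show ?thesis
      using null_sets_subset_filtration[OF t] sets_subset_initial_enlargement[of M F t G]
        subalgebra_filtration[OF t] by auto
  qed
  have "?\<phi> -` C \<inter> space M \<in> sets ?E"
    using measurable_sets[OF graph_measurable_initial_enlargement[of M F t G] C]
      subalgebra_filtration[OF t] by simp
  moreover have "?\<phi> -` (C - A) \<inter> space M \<in> sets ?E" "?\<phi> -` (A - C) \<inter> space M \<in> sets ?E"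
    by (rule null; blast)+
  \<comment> \<open>\<open>A\<close> is recovered from \<open>C\<close> by removing and adding
    pieces whose preimages are null and therefore in \<open>F t\<close>.\<close>
  ultimately have "(?\<phi> -` C \<inter> space M - ?\<phi> -` (C - A) \<inter> space M) \<union> (?\<phi> -` (A - C) \<inter> space M) \<in> sets ?E"
    by (rule sets.Un[OF sets.Diff])
  also have "(?\<phi> -` C \<inter> space M - ?\<phi> -` (C - A) \<inter> space M) \<union> (?\<phi> -` (A - C) \<inter> space M) = ?\<phi> -` A \<inter> space M"
    by auto
  finally show ?thesis .
qed

text \<open>Only generators need testing, and the adjoined null sets pull back to null sets of
  \<open>M\<close>, which already belong to \<open>F 0\<close>.\<close>

lemma graph_measurable_prod_filtration:
  assumes t: "t \<in> {0..T}"
  shows "(\<lambda>\<omega>. (\<omega>, G \<omega>)) \<in> initial_enlargement M F G t \<rightarrow>\<^sub>M prod_filtration M T F G t"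
  unfolding prod_filtration_def
proof (rule measurable_measure_of[OF prod_filtration_generators_subset])
  fix A assume "A \<in> (\<Inter>s\<in>{t<..}. sets (F (min s T) \<Otimes>\<^sub>M borel)) \<union> prod_null_sets M T F G"
  then show "(\<lambda>\<omega>. (\<omega>, G \<omega>)) -` A \<inter> space (initial_enlargement M F G t) \<in> sets (initial_enlargement M F G t)"
    using graph_vimage_Inter[OF t] graph_vimage_prod_null_sets null_sets_subset_filtration[OF t]
      sets_subset_initial_enlargement[of M F t G] subalgebra_filtration[OF t]
    by (auto simp del: INT_iff)
qed auto

section \<open>Transfer of stopping times in both directions\<close>

text \<open>Level sets of \<open>\<tau>\<close> pull back along the graph map; the almost sure
  equality changes them only by null sets of \<open>M\<close>, all of which lie in
  \<open>F t\<close>.\<close>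

lemma stopping_time_initial_enlargementI:
  assumes \<tau>': "random_time M \<tau>'"
    and \<tau>: "stopping_time_upto (completion (prod_prob M G)) T (prod_filtration M T F G) \<tau>"
    and eq: "AE \<omega> in M. \<tau>' \<omega> = \<tau> (\<omega>, G \<omega>)"
  shows "stopping_time_upto M T (initial_enlargement M F G) \<tau>'"
  unfolding stopping_time_upto_def
proof (intro conjI ballI \<tau>')
  fix t assume t: "t \<in> {0..T}"
  let ?E = "initial_enlargement M F G t"
  let ?S = "{\<omega> \<in> space M. \<tau>' \<omega> \<le> t}" and ?R = "{\<omega> \<in> space M. \<tau> (\<omega>, G \<omega>) \<le> t}"
  have null: "N \<in> sets ?E" if "N \<subseteq> (?S - ?R) \<union> (?R - ?S)" for N
  proof -
    have "AE \<omega> in M. \<omega> \<notin> N"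
      using eq by eventually_elim (use that in auto)
    then have "N \<in> null_sets M"
      using that by (auto simp: null_sets_iff_AE)
    then show ?thesis
      using null_sets_subset_filtration[OF t] sets_subset_initial_enlargement[of M F t G]
        subalgebra_filtration[OF t] by auto
  qed
  have "{z \<in> space M \<times> UNIV. \<tau> z \<le> t} \<in> sets (prod_filtration M T F G t)"
    using \<tau> t by (simp add: stopping_time_upto_def)
  from measurable_sets[OF graph_measurable_prod_filtration[OF t] this]
  have "(\<lambda>\<omega>. (\<omega>, G \<omega>)) -` {z \<in> space M \<times> UNIV. \<tau> z \<le> t} \<inter> space M \<in> sets ?E"
    by simp
  also have "(\<lambda>\<omega>. (\<omega>, G \<omega>)) -` {z \<in> space M \<times> UNIV. \<tau> z \<le> t} \<inter> space M = ?R"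
    by auto
  finally have "?R \<in> sets ?E" .
  moreover have "?R - ?S \<in> sets ?E" "?S - ?R \<in> sets ?E"
    by (rule null; blast)+
  ultimately have "(?R - (?R - ?S)) \<union> (?S - ?R) \<in> sets ?E"
    by (rule sets.Un[OF sets.Diff])
  also have "(?R - (?R - ?S)) \<union> (?S - ?R) = ?S"
    by auto
  finally show "?S \<in> sets ?E" .
qed

text \<open>Only values at most \<open>T\<close> are governed by the enlarged filtration; larger ones are
  carried over by \<open>u\<close>, which exceeds \<open>T\<close> everywhere.\<close>

lemma stopping_time_initial_enlargementE:
  assumes \<tau>': "stopping_time_upto M T (initial_enlargement M F G) \<tau>'"
  obtains \<tau> where "stopping_time_upto (completion (prod_prob M G)) T (prod_filtration M T F G) \<tau>"
    and "\<And>\<omega>. \<omega> \<in> space M \<Longrightarrow> \<tau>' \<omega> = \<tau> (\<omega>, G \<omega>)"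
proof -
  have [measurable]: "\<tau>' \<in> borel_measurable M" and \<tau>'_nonneg: "\<And>\<omega>. \<omega> \<in> space M \<Longrightarrow> 0 \<le> \<tau>' \<omega>"
    using \<tau>' by (auto simp: stopping_time_upto_def random_time_def)
  have "\<exists>A\<in>sets (F q \<Otimes>\<^sub>M borel). {\<omega> \<in> space M. \<tau>' \<omega> \<le> q} = (\<lambda>\<omega>. (\<omega>, G \<omega>)) -` A \<inter> space M"
    if q: "q \<in> {0..T}" for q
  proof (rule initial_enlargement_set_eq_graph_vimage[of M F q, OF subalgebra_filtration[OF q]])
    show "{\<omega> \<in> space M. \<tau>' \<omega> \<le> q} \<in> sets (initial_enlargement M F G q)"
      using \<tau>' q by (simp add: stopping_time_upto_def)
  qed
  then obtain A where A: "\<And>q. q \<in> {0..T} \<Longrightarrow> A q \<in> sets (F q \<Otimes>\<^sub>M borel)"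
    and A_graph: "\<And>q. q \<in> {0..T} \<Longrightarrow> {\<omega> \<in> space M. \<tau>' \<omega> \<le> q} = (\<lambda>\<omega>. (\<omega>, G \<omega>)) -` A q \<inter> space M"
    by metis
  \<comment> \<open>Countability preserves measurability of the infimum. \<open>T\<close> is
    inserted because, if it is irrational, no rational index in \<open>{0..T}\<close> reaches a
    value \<open>\<tau>' \<omega> = T\<close>.\<close>
  define Q where "Q = insert T (\<rat> \<inter> {0..T})"
  have Q: "T \<in> Q" "Q \<noteq> {}" "Q \<subseteq> {0..T}" and Q_countable[simp]: "countable Q"
    using T by (auto simp: Q_def countable_rat)
  define u where "u z = (if T < \<tau>' (fst z) then \<tau>' (fst z) else T + 1)" for z :: "'a \<times> real"
  have u: "T < u z" for z
    by (simp add: u_def)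
  \<comment> \<open>Outside \<open>A q\<close> the value \<open>u z\<close> stands in for infinity
    while keeping the infimum real; a point in no \<open>A q\<close> is sent to
    \<open>u z\<close>.\<close>
  define h where "h q z = (if z \<in> A q then q else u z)" for q z
  define \<tau> where "\<tau> z = (INF q\<in>Q. h q z)" for z
  have h_nonneg: "0 \<le> h q z" if "q \<in> Q" for q z
    using Q that u[of z] T by (auto simp: h_def)
  then have bdd: "bdd_below ((\<lambda>q. h q z) ` Q)" for z
    by (intro bdd_belowI2)
  have \<tau>_le: "\<tau> z \<le> h q z" if "q \<in> Q" for q z
    unfolding \<tau>_def by (rule cINF_lower[OF bdd that])
  have \<tau>_less: "\<tau> z < s \<longleftrightarrow> (\<exists>q\<in>Q. h q z < s)" for z s
    unfolding \<tau>_def by (rule cINF_less_iff[OF Q(2) bdd])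
  have \<tau>_ge: "s \<le> \<tau> z" if "\<And>q. q \<in> Q \<Longrightarrow> s \<le> h q z" for z s
    unfolding \<tau>_def by (rule cINF_greatest[OF Q(2) that])
  have A_subset: "A q \<subseteq> space M \<times> UNIV" if "q \<in> Q" for q
    using sets.sets_into_space[OF A, of q] subalgebra_filtration[of q] subsetD[OF Q(3) that]
    by (auto simp: space_pair_measure subalgebra_def)
  have "random_time (completion (prod_prob M G)) \<tau>"
    unfolding random_time_def
  proof (intro conjI ballI measurable_completion)
    have [measurable]: "A q \<in> sets (prod_prob M G)" if "q \<in> Q" for q
      using A[of q] subalgebra_prod_prob[of q] subsetD[OF Q(3) that] by (auto simp: subalgebra_def)
    have "fst \<in> prod_prob M G \<rightarrow>\<^sub>M M"
      unfolding prod_prob_def by simp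
    then have [measurable]: "(\<lambda>z. \<tau>' (fst z)) \<in> borel_measurable (prod_prob M G)"
      by (rule measurable_compose) simp
    have [measurable]: "h q \<in> borel_measurable (prod_prob M G)" if "q \<in> Q" for q
      using that unfolding h_def[abs_def] u_def by measurable
    show "\<tau> \<in> borel_measurable (prod_prob M G)"
      unfolding \<tau>_def[abs_def] by measurable
    show "0 \<le> \<tau> z" for z
      by (rule \<tau>_ge) (rule h_nonneg)
  qed
  moreover have "{z \<in> space (completion (prod_prob M G)). \<tau> z \<le> t} \<in> sets (prod_filtration M T F G t)"
    if t: "t \<in> {0..T}" for t
  proof -
    have "{z \<in> space M \<times> UNIV. \<tau> z \<le> t} \<in> sets (F (min s T) \<Otimes>\<^sub>M borel)" if s: "t < s" for s
    proof -
      define r where "r = min s T"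
      have r: "r \<in> {0..T}" "t \<le> r"
        using s t T by (auto simp: r_def)
      have A_r: "A q \<in> sets (F r \<Otimes>\<^sub>M borel)" if "q \<in> Q" "q \<le> r" for q
        using A[of q] sets_filtration_pair_mono[of q r] that r subsetD[OF Q(3) that(1)] by auto
      show ?thesis
      proof (cases "t = T")
        case True
        \<comment> \<open>Each \<open>h q z\<close> is either at most \<open>T\<close> or equal to
          \<open>u z > T\<close>, so the infimum is at most \<open>T\<close> exactly when some
          \<open>A q\<close> is hit.\<close>
        have "\<tau> z \<le> T \<longleftrightarrow> (\<exists>q\<in>Q. z \<in> A q)" for z
        proof
          assume "\<tau> z \<le> T"
          then have "\<tau> z < u z"
            using u[of z] by simp
          then show "\<exists>q\<in>Q. z \<in> A q"
            unfolding \<tau>_less by (auto simp: h_def split: if_splits)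
        next
          assume "\<exists>q\<in>Q. z \<in> A q"
          then show "\<tau> z \<le> T"
            using \<tau>_le[of _ z] Q(3) by (fastforce simp: h_def)
        qed
        then have "{z \<in> space M \<times> UNIV. \<tau> z \<le> t} = (\<Union>q\<in>Q. A q)"
          using A_subset True by auto
        moreover have "r = T"
          using True s by (simp add: r_def)
        ultimately show ?thesis
          using A_r Q(3) unfolding r_def[symmetric] by (auto intro!: sets.countable_UN')
      next
        case False
        then have tr: "t < r"
          using s t by (auto simp: r_def)
        \<comment> \<open>The levels \<open>a n\<close> decrease to \<open>t\<close> without
          exceeding \<open>r\<close>, so every \<open>A q\<close> with \<open>q < a n\<close>
          belongs to \<open>F r \<Otimes>\<^sub>M borel\<close>.\<close>
        define c where "c n = (r - t) * inverse (real (Suc n))" for n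
        define a where "a n = t + c n" for n
        have "0 < c n" "c n \<le> r - t" for n
          using tr unfolding c_def by (simp, intro mult_left_le) (auto intro: inverse_le_1_iff[THEN iffD2])
        then have a: "t < a n" "a n \<le> r" for n
          by (simp_all add: a_def le_diff_eq add.commute)
        have le: "\<tau> z \<le> t \<longleftrightarrow> (\<forall>n. \<tau> z < a n)" for z
        proof (intro iffI allI)
          fix n assume "\<tau> z \<le> t"
          then show "\<tau> z < a n" using a[of n] by simp
        next
          assume less: "\<forall>n. \<tau> z < a n"
          show "\<tau> z \<le> t"
          proof (rule ccontr)
            assume "\<not> \<tau> z \<le> t"
            then have "0 < (\<tau> z - t) / (r - t)"
              using tr by simp
            then obtain n where "inverse (real (Suc n)) < (\<tau> z - t) / (r - t)"
              using reals_Archimedean by blast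
            then have "a n < \<tau> z"
              using tr by (simp add: a_def c_def pos_less_divide_eq mult.commute)
            with less show False
              by (meson less_asym)
          qed
        qed
        \<comment> \<open>Since \<open>a n \<le> r \<le> T < u z\<close>, the default value cannot
          account for an infimum below \<open>a n\<close>.\<close>
        have less: "\<tau> z < a n \<longleftrightarrow> (\<exists>q\<in>Q \<inter> {..<a n}. z \<in> A q)" for z n
          using u[of z] a(2)[of n] r(1) unfolding \<tau>_less by (auto simp: h_def split: if_splits)
        \<comment> \<open>\<open>\<tau>\<close> is defined on the whole type, so its level set must
          be placed inside \<open>space M \<times> UNIV\<close>; one term of the intersection does
          this.\<close>
        have "(\<Union>q\<in>Q \<inter> {..<a 0}. A q) \<subseteq> space M \<times> UNIV"
          using A_subset by (intro UN_least) simp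
        moreover have "{z. \<tau> z \<le> t} = (\<Inter>n. \<Union>q\<in>Q \<inter> {..<a n}. A q)"
          unfolding le less by blast
        ultimately have "{z \<in> space M \<times> UNIV. \<tau> z \<le> t} = (\<Inter>n. \<Union>q\<in>Q \<inter> {..<a n}. A q)"
          by blast
        moreover have "(\<Union>q\<in>Q \<inter> {..<a n}. A q) \<in> sets (F r \<Otimes>\<^sub>M borel)" for n
          using A_r a(2)[of n] by (intro sets.countable_UN') fastforce+
        then have "(\<Inter>n. \<Union>q\<in>Q \<inter> {..<a n}. A q) \<in> sets (F r \<Otimes>\<^sub>M borel)"
          by (intro sets.countable_INT') auto
        ultimately show ?thesis
          by (simp add: r_def)
      qed
    qed
    then show ?thesis
      unfolding prod_filtration_def sets_measure_of[OF prod_filtration_generators_subset] by auto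
  qed
  ultimately have "stopping_time_upto (completion (prod_prob M G)) T (prod_filtration M T F G) \<tau>"
    by (simp add: stopping_time_upto_def)
  moreover have "\<tau>' \<omega> = \<tau> (\<omega>, G \<omega>)" if \<omega>: "\<omega> \<in> space M" for \<omega>
  proof (rule antisym)
    have in_A: "(\<omega>, G \<omega>) \<in> A q \<longleftrightarrow> \<tau>' \<omega> \<le> q" if "q \<in> Q" for q
      using A_graph[of q] \<omega> subsetD[OF Q(3) that] by auto
    \<comment> \<open>On the graph \<open>h q\<close> is either an index
      \<open>q \<ge> \<tau>' \<omega>\<close> or the default \<open>u\<close>, which is at least
      \<open>\<tau>' \<omega>\<close> by construction.\<close>
    show "\<tau>' \<omega> \<le> \<tau> (\<omega>, G \<omega>)"
      by (rule \<tau>_ge) (auto simp: h_def in_A u_def)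
    show "\<tau> (\<omega>, G \<omega>) \<le> \<tau>' \<omega>"
    proof (cases "T < \<tau>' \<omega>")
      case True
      \<comment> \<open>The point lies outside \<open>A T\<close>, so the index \<open>T\<close>
        yields the default value, here equal to \<open>\<tau>' \<omega>\<close>.\<close>
      then show ?thesis
        using \<tau>_le[OF Q(1), of "(\<omega>, G \<omega>)"] Q(1) by (simp add: h_def in_A u_def)
    next
      case False
      show ?thesis
      proof (rule dense_ge)
        fix s assume s: "\<tau>' \<omega> < s"
        \<comment> \<open>For \<open>s \<le> T\<close> a rational strictly between
          \<open>\<tau>' \<omega>\<close> and \<open>s\<close> works; for larger \<open>s\<close>
          the index \<open>T\<close> does, as \<open>\<tau>' \<omega> \<le> T\<close>.\<close>
        obtain q where q: "q \<in> Q" "\<tau>' \<omega> \<le> q" "q \<le> s"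
        proof (cases "s \<le> T")
          case True
          obtain q where "q \<in> \<rat>" "\<tau>' \<omega> < q" "q < s"
            using Rats_dense_in_real[OF s] by auto
          then show ?thesis
            using that[of q] True \<tau>'_nonneg[OF \<omega>] by (auto simp: Q_def)
        next
          case False
          then show ?thesis
            using that[of T] \<open>\<not> T < \<tau>' \<omega>\<close> Q(1) by auto
        qed
        then show "\<tau> (\<omega>, G \<omega>) \<le> s"
          using \<tau>_le[OF q(1), of "(\<omega>, G \<omega>)"] by (simp add: h_def in_A)
      qed
    qed
  qed
  ultimately show ?thesis
    using that by blast
qed

end

theorem proposition3p3:
  fixes M :: "'a measure" and T :: real and F :: "real \<Rightarrow> 'a measure"
    and G :: "'a \<Rightarrow> real" and \<tau>' :: "'a \<Rightarrow> real"
  assumes "0 < T"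
    and "prob_space M"
    and "complete_measure M"
    and "filtration_upto M T F"
    and "right_continuous_upto T F"
    and "null_sets M \<subseteq> sets (F 0)"
    and "trivial_algebra M (F 0)"
    and "G \<in> borel_measurable M"
    and "density_hypothesis M T F G"
    and "random_time M \<tau>'"
  shows "stopping_time_upto M T (initial_enlargement M F G) \<tau>' \<longleftrightarrow>
    (\<exists>\<tau> :: 'a \<times> real \<Rightarrow> real.
       stopping_time_upto (completion (prod_prob M G)) T (prod_filtration M T F G) \<tau> \<and>
       (AE \<omega> in M. \<tau>' \<omega> = \<tau> (\<omega>, G \<omega>)))"
proof
  assume "stopping_time_upto M T (initial_enlargement M F G) \<tau>'"
  from stopping_time_initial_enlargementE[OF assms(1-6,8,9) this]
  obtain \<tau> where "stopping_time_upto (completion (prod_prob M G)) T (prod_filtration M T F G) \<tau>"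
    and "\<And>\<omega>. \<omega> \<in> space M \<Longrightarrow> \<tau>' \<omega> = \<tau> (\<omega>, G \<omega>)"
    by blast
  then show "\<exists>\<tau>. stopping_time_upto (completion (prod_prob M G)) T (prod_filtration M T F G) \<tau> \<and>
      (AE \<omega> in M. \<tau>' \<omega> = \<tau> (\<omega>, G \<omega>))"
    by (intro exI[of _ \<tau>] conjI AE_I2)
next
  assume "\<exists>\<tau>. stopping_time_upto (completion (prod_prob M G)) T (prod_filtration M T F G) \<tau> \<and>
      (AE \<omega> in M. \<tau>' \<omega> = \<tau> (\<omega>, G \<omega>))"
  then show "stopping_time_upto M T (initial_enlargement M F G) \<tau>'"
    using stopping_time_initial_enlargementI[OF assms(1-6,8,9,10)] by blast
qed

end
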